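(* Let $\Bbbk$ be a field, let $n\ge 1$, let $R=\Bbbk[x_1,x_2,\ldots,x_n]$, and let $d_1,d_2,\ldots,d_n$ be positive integers. If the characteristic of $\Bbbk$ is zero or greater than $d_1+d_2+\cdots+d_n-n$, then the algebra $R/(x_1^{d_1},x_2^{d_2},\ldots,x_n^{d_n})$ has the strong Lefschetz property.
   Context: $R$ carries the standard grading ($\deg x_i=1$), and $A_i$ denotes the degree-$i$ component of a graded quotient $A=R/I$ by a homogeneous ideal $I$. A graded artinian $\Bbbk$-algebra $A=R/I$ is said to have the strong Lefschetz property if there is a linear form $\ell\in A_1$ such that, for all $i\ge 0$ and all $s\ge 0$, the multiplication map $\times\ell^s: A_i\to A_{i+s}$ has maximal rank, i.e. is injective or surjective. *)

theory Defs
  imports "HOL-Library.Poly_Mapping" "HOL-Library.Cardinality" "HOL-Algebra.Algebraic_Closure_Type"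
begin

text \<open>
  Exponent vectors are finitely supported functions \<open>'n \<Rightarrow>\<^sub>0 nat\<close>, so for a finite index type
  \<open>'n\<close> with \<open>n = CARD('n)\<close> elements (automatically \<open>n \<ge> 1\<close>) the type below, with its convolution
  product, is the polynomial ring in \<open>n\<close> indeterminates.
\<close>

type_synonym ('n, 'k) mpoly = "('n \<Rightarrow>\<^sub>0 nat) \<Rightarrow>\<^sub>0 'k"

definition Var :: "'n \<Rightarrow> ('n, 'k::comm_ring_1) mpoly" where
  "Var i = Poly_Mapping.single (Poly_Mapping.single i 1) 1"

definition mpoly_ring :: "('n, 'k::comm_ring_1) mpoly ring" where
  "mpoly_ring = ring_of_type_algebra"

definition monom_degree :: "('n::finite \<Rightarrow>\<^sub>0 nat) \<Rightarrow> nat" where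
  "monom_degree m = (\<Sum>i\<in>UNIV. Poly_Mapping.lookup m i)"

text \<open>As usual, the zero polynomial is homogeneous of every degree.\<close>

definition homogeneous :: "nat \<Rightarrow> ('n::finite, 'k::comm_ring_1) mpoly \<Rightarrow> bool" where
  "homogeneous i p \<longleftrightarrow> (\<forall>m \<in> Poly_Mapping.keys p. monom_degree m = i)"

definition homogeneous_ideal :: "('n::finite, 'k::comm_ring_1) mpoly set \<Rightarrow> bool" where
  "homogeneous_ideal I \<longleftrightarrow> (\<exists>S. (\<forall>p\<in>S. \<exists>i. homogeneous i p) \<and> I = Idl\<^bsub>mpoly_ring\<^esub> S)"

definition artinian_ring :: "('a, 'b) ring_scheme \<Rightarrow> bool" where
  "artinian_ring A \<longleftrightarrow> ring A \<and>
     (\<forall>C :: nat \<Rightarrow> 'a set. (\<forall>k. ideal (C k) A) \<and> decseq C \<longrightarrow> (\<exists>N. \<forall>k\<ge>N. C k = C N))"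

text \<open>The degree-\<open>i\<close> component of the quotient by \<open>I\<close>: the cosets of the forms of degree \<open>i\<close>.\<close>

definition graded_component ::
  "('n::finite, 'k::comm_ring_1) mpoly set \<Rightarrow> nat \<Rightarrow> ('n, 'k) mpoly set set" where
  "graded_component I i = (\<lambda>p. I +>\<^bsub>mpoly_ring\<^esub> p) ` {p. homogeneous i p}"

text \<open>
  The strong Lefschetz property of the quotient by \<open>I\<close>. It is a notion for graded artinian
  quotients only, so homogeneity of \<open>I\<close> and the artinian condition are part of the predicate.
\<close>

definition strong_Lefschetz_property :: "('n::finite, 'k::field) mpoly set \<Rightarrow> bool" where
  "strong_Lefschetz_property I \<longleftrightarrow>
     homogeneous_ideal I \<and> artinian_ring (mpoly_ring Quot I) \<and>
     (\<exists>l \<in> graded_component I 1. \<forall>i s :: nat.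
        let f = (\<lambda>a. l [^]\<^bsub>mpoly_ring Quot I\<^esub> s \<otimes>\<^bsub>mpoly_ring Quot I\<^esub> a) in
          inj_on f (graded_component I i) \<or>
          f ` graded_component I i = graded_component I (i + s))"

end

(*
  Take the linear form lin = x_1 + ... + x_n and the operator F acting on the i-th variable by
  x_i^j |-> j (d_i - j) x_i^(j-1). It preserves the ideal (x_1^d_1, ..., x_n^d_n), and on forms of
  degree r it satisfies the sl_2 relation [F, lin] = -(2r - D), where D = sum (d_i - 1) is the socle
  degree; hence [F, lin^(m+1)] = -(m+1)(2r - D + m) lin^m. If lin^s a = 0 with deg a = r and
  s + 2r <= D, then lin^(s+1) (F a) = 0, so F a = 0 by induction on r, and the commutation relation
  gives lin^(s-1) a = 0 up to a scalar whose factors are integers between 1 and D in absolute value.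
  Surjectivity when s + 2r >= D follows by the dual descending induction. Working with polynomials
  modulo the ideal avoids all dimension counts.
*)
theory Submission
  imports Defs
begin

subsection \<open>The raising and lowering operators\<close>

definition unit_vec :: "'n \<Rightarrow> 'n \<Rightarrow>\<^sub>0 nat" where
  "unit_vec i = Poly_Mapping.single i 1"

lemma lookup_unit_vec: "Poly_Mapping.lookup (unit_vec i) j = (if i = j then 1 else 0)"
  by (simp add: unit_vec_def lookup_single)

lemma minus_unit_vec_add:
  "Poly_Mapping.lookup m i \<noteq> 0 \<Longrightarrow> m - unit_vec i + unit_vec i = m"
  by (auto intro!: poly_mapping_eqI simp: lookup_add lookup_minus lookup_unit_vec)

text \<open>By cancellation at most one \<open>b\<close> satisfies \<open>m = a + b\<close>, so the
  convolution sum has at most one nonzero term. Subtraction of exponents truncates, hence the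
  explicit existence test.\<close>

lemma lookup_single_mult:
  fixes p :: "('a::cancel_comm_monoid_add) \<Rightarrow>\<^sub>0 ('k::comm_semiring_1)"
  shows "Poly_Mapping.lookup (Poly_Mapping.single a c * p) m =
    (if \<exists>b. m = a + b then c * Poly_Mapping.lookup p (m - a) else 0)"
proof -
  have "Poly_Mapping.lookup (Poly_Mapping.single a c * p) m =
      (\<Sum>l. (c * (\<Sum>q. Poly_Mapping.lookup p q when m = a + q)) when l = a)"
    unfolding lookup_mult by (rule arg_cong[of _ _ Sum_any]) (auto simp: lookup_single when_def)
  also have "\<dots> = c * (\<Sum>q. Poly_Mapping.lookup p q when m = a + q)"
    by simp
  also have "\<dots> = (if \<exists>b. m = a + b then c * Poly_Mapping.lookup p (m - a) else 0)"
  proof (cases "\<exists>b. m = a + b")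
    case True
    then obtain b where b: "m = a + b" by blast
    have "(\<Sum>q. Poly_Mapping.lookup p q when m = a + q) = (\<Sum>q. Poly_Mapping.lookup p q when q = b)"
      by (rule arg_cong[of _ _ Sum_any]) (auto simp: b when_def)
    then show ?thesis by (simp add: b)
  next
    case False
    then have "(\<lambda>q. Poly_Mapping.lookup p q when m = a + q) = (\<lambda>q. 0)"
      by (auto simp: when_def)
    then show ?thesis using False by simp
  qed
  finally show ?thesis .
qed

lemma lookup_const_mult:
  "Poly_Mapping.lookup (Poly_Mapping.single 0 c * p) m = c * Poly_Mapping.lookup p m"
  for p :: "('a::cancel_comm_monoid_add) \<Rightarrow>\<^sub>0 ('k::comm_semiring_1)"
  by (simp add: lookup_single_mult)

lemma lookup_of_int_mult:
  "Poly_Mapping.lookup (of_int z * p) m = of_int z * Poly_Mapping.lookup p m"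
  for p :: "('a::cancel_comm_monoid_add) \<Rightarrow>\<^sub>0 ('k::comm_ring_1)"
  by (simp add: lookup_const_mult flip: single_of_int)

lemma lookup_Var_mult:
  "Poly_Mapping.lookup (Var i * p) m =
    (if Poly_Mapping.lookup m i = 0 then 0 else Poly_Mapping.lookup p (m - unit_vec i))"
proof -
  have "(\<exists>b. m = unit_vec i + b) \<longleftrightarrow> Poly_Mapping.lookup m i \<noteq> 0"
  proof
    assume "Poly_Mapping.lookup m i \<noteq> 0"
    then have "m = unit_vec i + (m - unit_vec i)"
      by (metis minus_unit_vec_add add.commute)
    then show "\<exists>b. m = unit_vec i + b" by blast
  qed (auto simp: lookup_add lookup_unit_vec)
  then show ?thesis by (simp add: Var_def lookup_single_mult flip: unit_vec_def One_nat_def)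
qed

text \<open>Coefficientwise form of \<open>x\<^sub>i\<^sup>j \<mapsto> j (d\<^sub>i - j) x\<^sub>i\<^sup>j\<^sup>-\<^sup>1\<close>; the factor \<open>d\<^sub>i - j\<close>
  vanishes at \<open>j = d\<^sub>i\<close>, which is why the ideal is preserved.\<close>

lift_definition lower_var ::
  "('n \<Rightarrow> nat) \<Rightarrow> 'n \<Rightarrow> ('n, 'k::comm_ring_1) mpoly \<Rightarrow> ('n, 'k) mpoly"
  is "\<lambda>d i p m. of_int ((int (Poly_Mapping.lookup m i) + 1) * (int (d i) - 1 - int (Poly_Mapping.lookup m i)))
        * p (m + unit_vec i)"
proof -
  fix d :: "'n \<Rightarrow> nat" and i and p :: "('n \<Rightarrow>\<^sub>0 nat) \<Rightarrow> 'k"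
  assume fin: "finite {m. p m \<noteq> 0}"
  show "finite {m. of_int ((int (Poly_Mapping.lookup m i) + 1) * (int (d i) - 1 - int (Poly_Mapping.lookup m i)))
        * p (m + unit_vec i) \<noteq> 0}" (is "finite ?S")
  proof (rule finite_subset)
    show "?S \<subseteq> (\<lambda>m. m - unit_vec i) ` {m. p m \<noteq> 0}"
    proof
      fix m assume "m \<in> ?S"
      then have "m + unit_vec i \<in> {m. p m \<noteq> 0}" by auto
      then show "m \<in> (\<lambda>m. m - unit_vec i) ` {m. p m \<noteq> 0}"
        by (rule rev_image_eqI) simp
    qed
  qed (use fin in simp)
qed

definition lowering :: "('n::finite \<Rightarrow> nat) \<Rightarrow> ('n, 'k::comm_ring_1) mpoly \<Rightarrow> ('n, 'k) mpoly" where
  "lowering d p = (\<Sum>i\<in>UNIV. lower_var d i p)"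

definition lin :: "('n::finite, 'k::comm_ring_1) mpoly" where
  "lin = (\<Sum>i\<in>UNIV. Var i)"

text \<open>For positive \<open>d i\<close>, the top nonzero degree of the quotient, attained by the
  monomial with all exponents \<open>d i - 1\<close>. It is an integer because
  \<open>2 r - D\<close> takes both signs.\<close>

definition socle_degree :: "('n::finite \<Rightarrow> nat) \<Rightarrow> int" where
  "socle_degree d = (\<Sum>i\<in>UNIV. int (d i) - 1)"

lemma lower_var_diff: "lower_var d i (p - q) = lower_var d i p - lower_var d i q"
  by (rule poly_mapping_eqI) (simp add: lower_var.rep_eq lookup_minus algebra_simps)

lemma lowering_diff: "lowering d (p - q) = lowering d p - lowering d q"
  by (simp add: lowering_def lower_var_diff sum_subtractf)

lemma lower_var_add: "lower_var d i (p + q) = lower_var d i p + lower_var d i q"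
  by (rule poly_mapping_eqI) (simp add: lower_var.rep_eq lookup_add algebra_simps)

lemma lower_var_0: "lower_var d i 0 = 0"
  by (rule poly_mapping_eqI) (simp add: lower_var.rep_eq)

lemma lower_var_sum: "lower_var d i (sum f S) = (\<Sum>x\<in>S. lower_var d i (f x))"
  by (induction S rule: infinite_finite_induct) (simp_all add: lower_var_0 lower_var_add)

text \<open>The sl_2 relation in one variable. With \<open>j\<close> the exponent and
  \<open>e = d i - 1\<close> it is the identity
  \<open>(j + 1) (e - j) - j (e + 1 - j) = e - 2 j\<close>.\<close>

lemma commutator_same:
  "Poly_Mapping.lookup (lower_var d i (Var i * p)) m =
   Poly_Mapping.lookup (Var i * lower_var d i p) m
     - of_int (2 * int (Poly_Mapping.lookup m i) - (int (d i) - 1)) * Poly_Mapping.lookup p m"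
proof -
  have "Poly_Mapping.lookup (Var i * p) (m + unit_vec i) = Poly_Mapping.lookup p m"
    by (simp add: lookup_Var_mult lookup_add lookup_unit_vec)
  then have *: "Poly_Mapping.lookup (lower_var d i (Var i * p)) m =
      of_int ((int (Poly_Mapping.lookup m i) + 1) * (int (d i) - 1 - int (Poly_Mapping.lookup m i)))
        * Poly_Mapping.lookup p m"
    by (simp only: lower_var.rep_eq)
  have **: "Poly_Mapping.lookup (Var i * lower_var d i p) m =
      of_int (int (Poly_Mapping.lookup m i) * (int (d i) - int (Poly_Mapping.lookup m i)))
        * Poly_Mapping.lookup p m"
    \<comment> \<open>At exponent 0 both sides vanish; otherwise the subtraction of
      \<open>unit_vec i\<close> is genuine.\<close>
    by (cases "Poly_Mapping.lookup m i = 0")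
      (simp_all add: lookup_Var_mult lower_var.rep_eq minus_unit_vec_add lookup_minus
        lookup_unit_vec of_nat_diff)
  show ?thesis
    unfolding * ** left_diff_distrib[symmetric] of_int_diff[symmetric]
    by (rule arg_cong[of _ _ "\<lambda>z. of_int z * _"]) (simp add: algebra_simps)
qed

text \<open>The two operators shift different exponents, and the scalar in
  \<open>lower_var d j\<close> depends only on the exponent of \<open>j\<close>, which
  \<open>Var i\<close> leaves alone.\<close>

lemma commutator_distinct:
  assumes "i \<noteq> j"
  shows "lower_var d j (Var i * p) = Var i * lower_var d j p"
proof (rule poly_mapping_eqI)
  fix m
  have "m + unit_vec j - unit_vec i = m - unit_vec i + unit_vec j"
    if "Poly_Mapping.lookup m i \<noteq> 0"
    using that assms
    by (auto intro!: poly_mapping_eqI simp: lookup_add lookup_minus lookup_unit_vec)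
  then show "Poly_Mapping.lookup (lower_var d j (Var i * p)) m =
      Poly_Mapping.lookup (Var i * lower_var d j p) m"
    using assms
    by (simp add: lower_var.rep_eq lookup_Var_mult lookup_add lookup_minus lookup_unit_vec)
qed

text \<open>Only the diagonal terms of the double sum over variables contribute to the commutator.
  Their scalars add up to twice the degree of the monomial minus the socle degree.\<close>

lemma lowering_lin_mult:
  assumes "homogeneous r p"
  shows "lowering d (lin * p) = lin * lowering d p - of_int (2 * int r - socle_degree d) * p"
proof (rule poly_mapping_eqI)
  fix m
  have eq: "Poly_Mapping.lookup (lower_var d j (Var i * p)) m =
      Poly_Mapping.lookup (Var i * lower_var d j p) m
        - (if i = j then of_int (2 * int (Poly_Mapping.lookup m i) - (int (d i) - 1)) * Poly_Mapping.lookup p m else 0)"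
    for i j
    using commutator_same[of d i p m] commutator_distinct[of i j d p] by auto
  have "Poly_Mapping.lookup (lowering d (lin * p)) m =
      (\<Sum>j\<in>UNIV. \<Sum>i\<in>UNIV. Poly_Mapping.lookup (lower_var d j (Var i * p)) m)"
    by (simp add: lowering_def lin_def sum_distrib_right lower_var_sum lookup_sum)
  also have "\<dots> = (\<Sum>j\<in>UNIV. \<Sum>i\<in>UNIV. Poly_Mapping.lookup (Var i * lower_var d j p) m) -
      (\<Sum>j\<in>UNIV. of_int (2 * int (Poly_Mapping.lookup m j) - (int (d j) - 1)) * Poly_Mapping.lookup p m)"
    by (simp only: eq sum_subtractf sum.delta finite UNIV_I if_True)
  also have "(\<Sum>j\<in>UNIV. \<Sum>i\<in>UNIV. Poly_Mapping.lookup (Var i * lower_var d j p) m) =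
      Poly_Mapping.lookup (lin * lowering d p) m"
    by (subst sum.swap) (simp add: lowering_def lin_def sum_product lookup_sum)
  also have "(\<Sum>j\<in>UNIV. of_int (2 * int (Poly_Mapping.lookup m j) - (int (d j) - 1)) * Poly_Mapping.lookup p m)
      = of_int (\<Sum>j\<in>UNIV. 2 * int (Poly_Mapping.lookup m j) - (int (d j) - 1)) * Poly_Mapping.lookup p m"
    by (simp only: of_int_sum sum_distrib_right)
  also have "(\<Sum>j\<in>UNIV. 2 * int (Poly_Mapping.lookup m j) - (int (d j) - 1)) =
      2 * int (monom_degree m) - socle_degree d"
    by (simp add: sum_subtractf monom_degree_def socle_degree_def sum_distrib_left)
  \<comment> \<open>Homogeneity fixes the degree on the support of \<open>p\<close>; off the support
    both sides are 0.\<close>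
  also have "of_int (2 * int (monom_degree m) - socle_degree d) * Poly_Mapping.lookup p m =
      of_int (2 * int r - socle_degree d) * Poly_Mapping.lookup p m"
    using assms by (cases "m \<in> Poly_Mapping.keys p") (auto simp: homogeneous_def in_keys_iff)
  finally show "Poly_Mapping.lookup (lowering d (lin * p)) m =
      Poly_Mapping.lookup (lin * lowering d p - of_int (2 * int r - socle_degree d) * p) m"
    by (simp only: lookup_minus lookup_of_int_mult)
qed

section \<open>Degrees and homogeneous forms\<close>

lemma monom_degree_add: "monom_degree (a + b) = monom_degree a + monom_degree b"
  by (simp add: monom_degree_def lookup_add sum.distrib)

lemma monom_degree_unit_vec [simp]: "monom_degree (unit_vec i) = 1"
  by (simp add: monom_degree_def lookup_unit_vec)

lemma homogeneous_0 [simp]: "homogeneous i 0"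
  by (simp add: homogeneous_def)

lemma homogeneous_add: "homogeneous i p \<Longrightarrow> homogeneous i q \<Longrightarrow> homogeneous i (p + q)"
  using keys_add[of p q] by (auto simp: homogeneous_def)

lemma homogeneous_diff: "homogeneous i p \<Longrightarrow> homogeneous i q \<Longrightarrow> homogeneous i (p - q)"
  using keys_diff[of p q] by (auto simp: homogeneous_def)

lemma homogeneous_sum: "(\<And>x. x \<in> S \<Longrightarrow> homogeneous i (f x)) \<Longrightarrow> homogeneous i (sum f S)"
  by (induction S rule: infinite_finite_induct) (simp_all add: homogeneous_add)

lemma homogeneous_mult: "homogeneous i p \<Longrightarrow> homogeneous j q \<Longrightarrow> homogeneous (i + j) (p * q)"
  using keys_mult[of p q] by (fastforce simp: homogeneous_def monom_degree_add)

lemma homogeneous_const_mult: "homogeneous i p \<Longrightarrow> homogeneous i (Poly_Mapping.single 0 c * p)"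
  by (auto simp: homogeneous_def in_keys_iff lookup_const_mult)

lemma homogeneous_one: "homogeneous 0 1"
  by (simp add: homogeneous_def monom_degree_def)

lemma homogeneous_power: "homogeneous i p \<Longrightarrow> homogeneous (s * i) (p ^ s)"
  by (induction s) (auto simp: homogeneous_one intro!: homogeneous_mult)

lemma homogeneous_Var: "homogeneous 1 (Var i)"
  by (simp add: homogeneous_def Var_def flip: unit_vec_def One_nat_def)

lemma homogeneous_lin: "homogeneous 1 lin"
  unfolding lin_def by (intro homogeneous_sum homogeneous_Var)

lemma homogeneous_lin_power_mult: "homogeneous i p \<Longrightarrow> homogeneous (i + s) (lin ^ s * p)"
  using homogeneous_mult[OF homogeneous_power[OF homogeneous_lin, of s]] by (simp add: add.commute)

lemma homogeneous_lower_var: "homogeneous (Suc r) p \<Longrightarrow> homogeneous r (lower_var d i p)"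
proof -
  assume p: "homogeneous (Suc r) p"
  show ?thesis
    unfolding homogeneous_def
  proof
    fix m assume "m \<in> Poly_Mapping.keys (lower_var d i p)"
    then have "m + unit_vec i \<in> Poly_Mapping.keys p"
      by (auto simp: in_keys_iff lower_var.rep_eq)
    with p have "monom_degree (m + unit_vec i) = Suc r"
      by (simp add: homogeneous_def)
    then show "monom_degree m = r" by (simp add: monom_degree_add)
  qed
qed

lemma homogeneous_lowering: "homogeneous (Suc r) p \<Longrightarrow> homogeneous r (lowering d p)"
  unfolding lowering_def by (intro homogeneous_sum homogeneous_lower_var)

text \<open>Stands in for the missing degree -1, about which \<open>homogeneous_lowering\<close>
  says nothing.\<close>

lemma lowering_degree_0:
  assumes "homogeneous 0 p"
  shows "lowering d p = 0"
proof -
  have "lower_var d i p = 0" for i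
  proof (rule poly_mapping_eqI)
    fix m
    have "m + unit_vec i \<notin> Poly_Mapping.keys p"
      using assms by (auto simp: homogeneous_def monom_degree_add)
    then show "Poly_Mapping.lookup (lower_var d i p) m = Poly_Mapping.lookup 0 m"
      by (simp add: lower_var.rep_eq in_keys_iff)
  qed
  then show ?thesis by (simp add: lowering_def)
qed

text \<open>Moving the operator past each factor \<open>lin\<close> contributes
  \<open>2 (r + k) - D\<close> for \<open>k = 0, ..., m\<close>; these sum to
  \<open>(m + 1) (2 r - D + m)\<close>.\<close>

lemma lowering_lin_power_mult:
  assumes "homogeneous r p"
  shows "lowering d (lin ^ Suc m * p) = lin ^ Suc m * lowering d p
    - of_int ((int m + 1) * (2 * int r - socle_degree d + int m)) * (lin ^ m * p)"
proof (induction m)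
  case 0
  then show ?case using lowering_lin_mult[OF assms, of d] by simp
next
  case (Suc m)
  have "lowering d (lin ^ Suc (Suc m) * p) = lowering d (lin * (lin ^ Suc m * p))"
    by (simp add: mult.assoc)
  also have "\<dots> = lin * lowering d (lin ^ Suc m * p)
      - of_int (2 * int (r + Suc m) - socle_degree d) * (lin ^ Suc m * p)"
    by (intro lowering_lin_mult homogeneous_lin_power_mult assms)
  finally show ?case
    unfolding Suc by (simp add: algebra_simps)
qed

subsection \<open>Multiplication by powers of the linear form modulo the ideal\<close>

text \<open>The monomial ideal described through supports, which makes membership a matter of single
  coefficients. \<open>Idl_Var_powers\<close> identifies it with the generated ideal.\<close>

definition power_ideal :: "('n \<Rightarrow> nat) \<Rightarrow> ('n, 'k::comm_ring_1) mpoly set" where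
  "power_ideal d = {p. \<forall>m\<in>Poly_Mapping.keys p. \<exists>i. d i \<le> Poly_Mapping.lookup m i}"

lemma power_ideal_0: "0 \<in> power_ideal d"
  by (simp add: power_ideal_def)

lemma power_ideal_add: "p \<in> power_ideal d \<Longrightarrow> q \<in> power_ideal d \<Longrightarrow> p + q \<in> power_ideal d"
  using keys_add[of p q] by (auto simp: power_ideal_def)

lemma power_ideal_diff: "p \<in> power_ideal d \<Longrightarrow> q \<in> power_ideal d \<Longrightarrow> p - q \<in> power_ideal d"
  using keys_diff[of p q] by (auto simp: power_ideal_def)

lemma power_ideal_diff_iff: "p \<in> power_ideal d \<Longrightarrow> p - q \<in> power_ideal d \<longleftrightarrow> q \<in> power_ideal d"
  using power_ideal_diff[of p d "p - q"] power_ideal_diff[of p d q] by auto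

lemma power_ideal_diff_iff': "q \<in> power_ideal d \<Longrightarrow> p - q \<in> power_ideal d \<longleftrightarrow> p \<in> power_ideal d"
  using power_ideal_add[of "p - q" d q] power_ideal_diff[of p d q] by auto

lemma power_ideal_mult: "p \<in> power_ideal d \<Longrightarrow> q * p \<in> power_ideal d"
proof -
  assume p: "p \<in> power_ideal d"
  show ?thesis
    unfolding power_ideal_def
  proof safe
    fix m assume "m \<in> Poly_Mapping.keys (q * p)"
    then obtain a b where "m = a + b" "b \<in> Poly_Mapping.keys p"
      using keys_mult[of q p] by blast
    with p show "\<exists>i. d i \<le> Poly_Mapping.lookup m i"
      by (auto simp: power_ideal_def lookup_add intro: trans_le_add2)
  qed
qed

lemma power_ideal_sum: "(\<And>x. x \<in> S \<Longrightarrow> f x \<in> power_ideal d) \<Longrightarrow> sum f S \<in> power_ideal d"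
  by (induction S rule: infinite_finite_induct) (simp_all add: power_ideal_add power_ideal_0)

lemma lower_var_power_ideal:
  assumes "p \<in> power_ideal d"
  shows "lower_var d i p \<in> power_ideal d"
  unfolding power_ideal_def
proof safe
  fix m assume "m \<in> Poly_Mapping.keys (lower_var d i p)"
  then have *: "m + unit_vec i \<in> Poly_Mapping.keys p"
    and ne: "int (d i) - 1 - int (Poly_Mapping.lookup m i) \<noteq> 0"
    by (auto simp: in_keys_iff lower_var.rep_eq simp del: of_int_mult)
  from * assms obtain j where "d j \<le> Poly_Mapping.lookup (m + unit_vec i) j"
    by (auto simp: power_ideal_def)
  \<comment> \<open>The same \<open>j\<close> works: for \<open>j = i\<close>, \<open>ne\<close>
    excludes the exponent \<open>d i - 1\<close>, the only one at which losing a factor crosses the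
    bound.\<close>
  with ne show "\<exists>j. d j \<le> Poly_Mapping.lookup m j"
    by (intro exI[of _ j]) (auto simp: lookup_add lookup_unit_vec split: if_splits)
qed

lemma lowering_power_ideal: "p \<in> power_ideal d \<Longrightarrow> lowering d p \<in> power_ideal d"
  unfolding lowering_def by (intro power_ideal_sum lower_var_power_ideal)

text \<open>A monomial with every exponent at most \<open>d i - 1\<close> has degree at most the
  socle degree.\<close>

lemma power_ideal_high_degree:
  assumes "homogeneous r p" "int r > socle_degree d"
  shows "p \<in> power_ideal d"
  unfolding power_ideal_def
proof safe
  fix m assume m: "m \<in> Poly_Mapping.keys p"
  show "\<exists>i. d i \<le> Poly_Mapping.lookup m i"
  proof (rule ccontr)
    assume "\<nexists>i. d i \<le> Poly_Mapping.lookup m i"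
    then have "int (Poly_Mapping.lookup m i) \<le> int (d i) - 1" for i
      by (simp add: not_le)
    then have "(\<Sum>i\<in>UNIV. int (Poly_Mapping.lookup m i)) \<le> socle_degree d"
      unfolding socle_degree_def by (intro sum_mono)
    moreover have "monom_degree m = r" using m assms(1) by (simp add: homogeneous_def)
    ultimately show False using assms(2) by (auto simp: monom_degree_def)
  qed
qed

lemma power_ideal_of_int_cancel:
  assumes "of_int z * p \<in> power_ideal d" "(of_int z :: 'k::field) \<noteq> 0"
  shows "(p :: ('n, 'k) mpoly) \<in> power_ideal d"
  using assms by (auto simp: power_ideal_def in_keys_iff lookup_of_int_mult)

text \<open>Here the bound on the characteristic takes effect: a positive characteristic above
  \<open>N\<close> cannot divide \<open>z\<close>.\<close>

lemma of_int_nonzero_below_char: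
  assumes "CHAR('k) = 0 \<or> int CHAR('k) > N" "0 < z" "z \<le> N"
  shows "(of_int z :: 'k::ring_1) \<noteq> 0"
proof
  assume "(of_int z :: 'k) = 0"
  moreover from assms(2) obtain n where n: "z = int n" "n > 0" using pos_int_cases by blast
  ultimately have "CHAR('k) dvd n" by (simp add: of_nat_eq_0_iff_char_dvd)
  then show False using n assms(1,3) by (auto dest: dvd_imp_le)
qed

text \<open>Outer induction on \<open>r\<close> with \<open>s\<close> arbitrary, since lowering
  trades one degree for one more power of \<open>lin\<close>; inner induction on \<open>s\<close>
  removes the factors \<open>lin\<close> one by one.\<close>

lemma lin_power_injective:
  fixes a :: "('n::finite, 'k::field) mpoly"
  assumes char: "CHAR('k) = 0 \<or> int CHAR('k) > socle_degree d"
  shows "homogeneous r a \<Longrightarrow> int s + 2 * int r \<le> socle_degree d \<Longrightarrow>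
    lin ^ s * a \<in> power_ideal d \<Longrightarrow> a \<in> power_ideal d"
proof (induction r arbitrary: a s)
  \<comment> \<open>The inner induction, shared by both cases of the outer one; \<open>low\<close>
    is what the outer hypothesis will supply.\<close>
  have step: "a \<in> power_ideal d"
    if a: "homogeneous r a" "int s + 2 * int r \<le> socle_degree d" "lin ^ s * a \<in> power_ideal d"
      and low: "\<And>s. lin ^ s * a \<in> power_ideal d \<Longrightarrow> int s + 2 * int r \<le> socle_degree d \<Longrightarrow>
        lowering d a \<in> power_ideal d"
    for r s and a :: "('n, 'k) mpoly"
    using a
  proof (induction s)
    case (Suc s)
    have "lowering d (lin ^ Suc s * a) \<in> power_ideal d"
      using Suc.prems by (intro lowering_power_ideal)
    moreover have "lin ^ Suc s * lowering d a \<in> power_ideal d"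
      using Suc.prems low[of "Suc s"] by (intro power_ideal_mult)
    ultimately have "of_int ((int s + 1) * (2 * int r - socle_degree d + int s)) * (lin ^ s * a) \<in> power_ideal d"
      unfolding lowering_lin_power_mult[OF a(1)] by (simp only: power_ideal_diff_iff)
    moreover have "(of_int ((int s + 1) * (2 * int r - socle_degree d + int s)) :: 'k) \<noteq> 0"
    proof -
      \<comment> \<open>Both factors lie between 1 and the socle degree because
        \<open>Suc s + 2 r\<close> is at most the socle degree. The sign is reversed to have
        positive integers.\<close>
      have "(of_int (int s + 1) :: 'k) \<noteq> 0" "(of_int (socle_degree d - 2 * int r - int s) :: 'k) \<noteq> 0"
        using Suc.prems by (intro of_int_nonzero_below_char[OF char]; simp)+
      then have "(of_int ((int s + 1) * (socle_degree d - 2 * int r - int s)) :: 'k) \<noteq> 0"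
        unfolding of_int_mult by simp
      moreover have "(int s + 1) * (2 * int r - socle_degree d + int s) =
          - ((int s + 1) * (socle_degree d - 2 * int r - int s))"
        by (simp add: algebra_simps)
      ultimately show ?thesis by (metis of_int_minus neg_equal_0_iff_equal)
    qed
    ultimately have "lin ^ s * a \<in> power_ideal d"
      by (rule power_ideal_of_int_cancel)
    then show ?case using Suc by simp
  qed simp
  {
    case 0
    then show ?case
      by (intro step[of 0 a s]) (simp_all add: lowering_degree_0 power_ideal_0)
  next
    case (Suc r)
    show ?case
    proof (rule step[OF Suc.prems])
      fix t assume t: "lin ^ t * a \<in> power_ideal d" "int t + 2 * int (Suc r) \<le> socle_degree d"
      \<comment> \<open>With one extra factor \<open>lin\<close> the commutation formula applies,
        and its scalar term is already in the ideal.\<close>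
      have "lin ^ Suc t * a \<in> power_ideal d"
        using power_ideal_mult[OF t(1), of lin] by (simp add: mult.assoc)
      then have "lowering d (lin ^ Suc t * a) \<in> power_ideal d"
        by (rule lowering_power_ideal)
      moreover have "of_int ((int t + 1) * (2 * int (Suc r) - socle_degree d + int t)) * (lin ^ t * a) \<in> power_ideal d"
        using t(1) by (rule power_ideal_mult)
      ultimately have "lin ^ Suc t * lowering d a \<in> power_ideal d"
        unfolding lowering_lin_power_mult[OF Suc.prems(1)] by (simp only: power_ideal_diff_iff')
      moreover have "int (Suc t) + 2 * int r \<le> socle_degree d" using t by simp
      ultimately show "lowering d a \<in> power_ideal d"
        using Suc.IH[OF homogeneous_lowering[OF Suc.prems(1)]] by blast
    qed
  }
qed

text \<open>To divide \<open>y\<close> by one more power of \<open>lin\<close>, first divide \<open>lin * y\<close> (outer induction) and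
  \<open>y\<close> itself by \<open>lin ^ s\<close> (inner induction), and compare the images under the lowering operator.\<close>

lemma lin_power_surjective:
  fixes y :: "('n::finite, 'k::field) mpoly"
  assumes char: "CHAR('k) = 0 \<or> int CHAR('k) > socle_degree d"
  shows "homogeneous (r + s) y \<Longrightarrow> int s + socle_degree d \<le> 2 * int (r + s) \<Longrightarrow>
    \<exists>x. homogeneous r x \<and> y - lin ^ s * x \<in> power_ideal d"
proof (induction "nat (socle_degree d + 1 - int (r + s))" arbitrary: r s y)
  case 0
  \<comment> \<open>Measure 0 means that \<open>r + s\<close> exceeds the socle degree.\<close>
  then have "y \<in> power_ideal d" by (intro power_ideal_high_degree) auto
  then show ?case by (intro exI[of _ 0]) simp
next
  case (Suc N)
  note outer = Suc.hyps(1) and N = Suc.hyps(2)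
  from Suc.prems N show ?case
  proof (induction s arbitrary: r)
    case 0
    then show ?case by (intro exI[of _ y]) (simp add: power_ideal_0)
  next
    case (Suc s)
    \<comment> \<open>The degree of \<open>y\<close> is unchanged: one factor \<open>lin\<close>
      becomes one degree of \<open>x\<close>.\<close>
    obtain x where x: "homogeneous (Suc r) x" "y - lin ^ s * x \<in> power_ideal d"
      using Suc.IH[of "Suc r"] Suc.prems by auto
    have "homogeneous (r + Suc (Suc s)) (lin * y)"
      using homogeneous_mult[OF homogeneous_lin Suc.prems(1)] by simp
    \<comment> \<open>The degree of \<open>lin * y\<close> is one higher, so the measure drops to
      \<open>N\<close>; passing to \<open>Suc (Suc s)\<close> keeps the quotient \<open>z\<close> in
      degree \<open>r\<close>.\<close>
    then obtain z where z: "homogeneous r z" "lin * y - lin ^ Suc (Suc s) * z \<in> power_ideal d"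
    proof -
      have "N = nat (socle_degree d + 1 - int (r + Suc (Suc s)))"
        "int (Suc (Suc s)) + socle_degree d \<le> 2 * int (r + Suc (Suc s))"
        using Suc.prems by simp_all
      then show ?thesis
        using outer[of r "Suc (Suc s)" "lin * y"] \<open>homogeneous (r + Suc (Suc s)) (lin * y)\<close> that by blast
    qed
    \<comment> \<open>\<open>c\<close> and \<open>b\<close> are the scalars of the commutation
      formula for \<open>x\<close> and \<open>z\<close>. Only \<open>c\<close> has to be
      inverted.\<close>
    define c where "c = (int s + 1) * (2 * int (Suc r) - socle_degree d + int s)"
    define b where "b = (int (Suc s) + 1) * (2 * int r - socle_degree d + int (Suc s))"
    have c0: "(of_int c :: 'k) \<noteq> 0"
    proof -
      \<comment> \<open>The measure is \<open>Suc N\<close>, so \<open>r + Suc s\<close> is at most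
        the socle degree, which bounds both factors above; positivity of the second comes from the
        hypothesis on the exponent.\<close>
      have "(of_int (int s + 1) :: 'k) \<noteq> 0" "(of_int (2 * int (Suc r) - socle_degree d + int s) :: 'k) \<noteq> 0"
        using Suc.prems by (intro of_int_nonzero_below_char[OF char]; simp)+
      then show ?thesis by (simp add: c_def)
    qed
    have k: "lin * (y - lin ^ s * x) \<in> power_ideal d"
      "lin ^ Suc s * x = lin * y - lin * (y - lin ^ s * x)"
      by (rule power_ideal_mult[OF x(2)]) (simp add: algebra_simps)
    \<comment> \<open>\<open>u\<close> equals
      \<open>lin ^ Suc s * x - lin ^ Suc (Suc s) * z\<close>, written so that membership in the
      ideal is visible.\<close>
    define u where "u = lin * y - lin ^ Suc (Suc s) * z - lin * (y - lin ^ s * x)"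
    have u: "u \<in> power_ideal d" unfolding u_def using z(2) k(1) by (rule power_ideal_diff)
    have "lin ^ Suc s * x = lin ^ Suc (Suc s) * z - (0 - u)"
      unfolding u_def k(2) by simp
    then have low: "lowering d (lin ^ Suc s * x) = lowering d (lin ^ Suc (Suc s) * z) - lowering d (0 - u)"
      by (simp only: lowering_diff)
    have swap: "q = p - p'" if "p - q = p'" for p q p' :: "('n, 'k) mpoly"
      using that by auto
    from low have "lin ^ Suc s * lowering d x - of_int c * (lin ^ s * x) =
        lin ^ Suc (Suc s) * lowering d z - of_int b * (lin ^ Suc s * z) - lowering d (0 - u)"
      unfolding lowering_lin_power_mult[OF x(1)] lowering_lin_power_mult[OF z(1)]
      by (simp only: c_def b_def)
    \<comment> \<open>Solving for \<open>lin ^ s * x\<close>: every other term has a factor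
      \<open>lin ^ Suc s\<close> or lies in the ideal.\<close>
    then have "of_int c * (lin ^ s * x) = lin ^ Suc s * lowering d x -
        (lin ^ Suc (Suc s) * lowering d z - of_int b * (lin ^ Suc s * z) - lowering d (0 - u))"
      by (rule swap)
    also have "\<dots> = lin ^ Suc s * (lowering d x - lin * lowering d z + of_int b * z) + lowering d (0 - u)"
      by (simp add: ring_distribs mult.assoc mult.left_commute)
    finally have eq: "of_int c * (lin ^ s * x) =
        lin ^ Suc s * (lowering d x - lin * lowering d z + of_int b * z) + lowering d (0 - u)" .
    define w where "w = lowering d x - lin * lowering d z + of_int b * z"
    \<comment> \<open>The constant polynomial \<open>1 / c\<close>; the quotient of \<open>y\<close>
      by \<open>lin ^ Suc s\<close> will be \<open>C * w\<close>.\<close>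
    define C where "C = (Poly_Mapping.single 0 (inverse (of_int c)) :: ('n, 'k) mpoly)"
    have Cc: "C * of_int c = 1"
      using c0 by (simp add: C_def mult_single flip: single_of_int)
    have "lin ^ s * x = C * (of_int c * (lin ^ s * x))"
      using Cc by (simp flip: mult.assoc)
    also have "\<dots> = lin ^ Suc s * (C * w) + C * lowering d (0 - u)"
      unfolding eq w_def by (simp add: algebra_simps)
    finally have "y - lin ^ Suc s * (C * w) = (y - lin ^ s * x) + C * lowering d (0 - u)"
      by (simp add: algebra_simps)
    also have "\<dots> \<in> power_ideal d"
      using u by (intro power_ideal_add[OF x(2)] power_ideal_mult lowering_power_ideal
          power_ideal_diff[OF power_ideal_0])
    finally have "y - lin ^ Suc s * (C * w) \<in> power_ideal d" .
    moreover have "homogeneous r w"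
    proof -
      have "homogeneous r (lin * lowering d z)"
      proof (cases r)
        case 0
        then show ?thesis using z(1) by (simp add: lowering_degree_0)
      next
        case (Suc r')
        then show ?thesis
          using homogeneous_mult[OF homogeneous_lin homogeneous_lowering[of r' z d]] z(1) by simp
      qed
      moreover have "homogeneous r (of_int b * z)"
        using z(1) by (simp add: homogeneous_const_mult flip: single_of_int)
      ultimately show ?thesis
        unfolding w_def using x(1) by (intro homogeneous_add homogeneous_diff homogeneous_lowering)
    qed
    then have "homogeneous r (C * w)" by (simp add: C_def homogeneous_const_mult)
    ultimately show ?case by blast
  qed
qed

subsection \<open>The quotient ring\<close>

lemma mpoly_ring_simps [simp]:
  "carrier mpoly_ring = UNIV" "p \<otimes>\<^bsub>mpoly_ring\<^esub> q = p * q" "\<one>\<^bsub>mpoly_ring\<^esub> = 1"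
  "\<zero>\<^bsub>mpoly_ring\<^esub> = 0" "p \<oplus>\<^bsub>mpoly_ring\<^esub> q = p + q"
  by (simp_all add: mpoly_ring_def ring_of_type_algebra_def)

lemma cring_mpoly_ring: "cring (mpoly_ring :: ('n, 'k::comm_ring_1) mpoly ring)"
  unfolding mpoly_ring_def by (rule cring_from_type_algebra)

lemma ring_mpoly_ring: "ring (mpoly_ring :: ('n, 'k::comm_ring_1) mpoly ring)"
  using cring_mpoly_ring by (rule cring.axioms)

lemma ideal_power_ideal: "ideal (power_ideal d) (mpoly_ring :: ('n, 'k::comm_ring_1) mpoly ring)"
proof (rule idealI[OF ring_mpoly_ring])
  interpret ring "mpoly_ring :: ('n, 'k) mpoly ring" by (rule ring_mpoly_ring)
  show "subgroup (power_ideal d) (add_monoid (mpoly_ring :: ('n, 'k) mpoly ring))"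
  proof (rule group.subgroupI)
    show "Group.group (add_monoid (mpoly_ring :: ('n, 'k) mpoly ring))"
      by (rule add.is_group)
    show "power_ideal d \<noteq> ({} :: ('n, 'k) mpoly set)" using power_ideal_0 by blast
    fix p :: "('n, 'k) mpoly" assume p: "p \<in> power_ideal d"
    have "\<ominus>\<^bsub>mpoly_ring\<^esub> p = 0 - p"
      by (rule minus_equality) simp_all
    then show "inv\<^bsub>add_monoid mpoly_ring\<^esub> p \<in> power_ideal d"
      using power_ideal_diff[OF power_ideal_0 p] by (simp add: a_inv_def)
  qed (auto intro: power_ideal_add)
qed (use power_ideal_mult in \<open>auto simp: mult.commute\<close>)

section \<open>The ideal generated by the powers of the variables\<close>

lemma sum_monomials:
  "(\<Sum>m\<in>Poly_Mapping.keys p. Poly_Mapping.single m (Poly_Mapping.lookup p m)) = p"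
  by (rule poly_mapping_eqI) (simp add: lookup_sum lookup_single when_def in_keys_iff)

lemma Var_power: "Var i ^ s = Poly_Mapping.single (Poly_Mapping.single i s) 1"
  by (induction s) (simp_all add: Var_def mult_single flip: single_add)

text \<open>The generators lie in \<open>power_ideal d\<close>; conversely each term of a member is
  a multiple of some generator, and the member is the finite sum of its terms.\<close>

lemma Idl_Var_powers:
  "Idl\<^bsub>mpoly_ring\<^esub> {Var i ^ d i | i. i \<in> UNIV} = (power_ideal d :: ('n, 'k::comm_ring_1) mpoly set)"
    (is "?J = _")
proof
  interpret ring "mpoly_ring :: ('n, 'k) mpoly ring" by (rule ring_mpoly_ring)
  show "?J \<subseteq> power_ideal d"
  proof (rule genideal_minimal[OF ideal_power_ideal], safe)
    fix i
    show "Var i ^ d i \<in> (power_ideal d :: ('n, 'k) mpoly set)"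
      by (auto simp: power_ideal_def Var_power intro: exI[of _ i])
  qed
  interpret J: ideal ?J mpoly_ring
    by (rule genideal_ideal) simp
  show "power_ideal d \<subseteq> ?J"
  proof
    fix p :: "('n, 'k) mpoly" assume p: "p \<in> power_ideal d"
    have monomial: "Poly_Mapping.single m (Poly_Mapping.lookup p m) \<in> ?J" if m: "m \<in> Poly_Mapping.keys p" for m
    proof -
      obtain i where i: "d i \<le> Poly_Mapping.lookup m i" using p m by (auto simp: power_ideal_def)
      then have "m = (m - Poly_Mapping.single i (d i)) + Poly_Mapping.single i (d i)"
        by (auto intro!: poly_mapping_eqI simp: lookup_add lookup_minus lookup_single when_def)
      then have "Poly_Mapping.single m (Poly_Mapping.lookup p m) =
          Poly_Mapping.single (m - Poly_Mapping.single i (d i)) (Poly_Mapping.lookup p m) * Var i ^ d i"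
        by (simp add: Var_power mult_single)
      moreover have "Var i ^ d i \<in> ?J"
        using genideal_self[of "{Var i ^ d i | i. i \<in> UNIV}"] by auto
      ultimately show ?thesis
        using J.I_l_closed[of "Var i ^ d i"] by simp
    qed
    have "(\<Sum>m\<in>S. Poly_Mapping.single m (Poly_Mapping.lookup p m)) \<in> ?J"
      if "S \<subseteq> Poly_Mapping.keys p" for S
      using finite_subset[OF that finite_keys] that
    proof (induction S rule: finite_induct)
      case empty
      show ?case using J.zero_closed by simp
    next
      case (insert m S)
      then show ?case using J.a_closed monomial by simp
    qed
    from this[OF order_refl] show "p \<in> ?J"
      unfolding sum_monomials .
  qed
qed

lemma coset_mpoly_ring:
  "power_ideal d +>\<^bsub>mpoly_ring\<^esub> p = {q :: ('n, 'k::comm_ring_1) mpoly. q - p \<in> power_ideal d}"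
proof -
  have "q \<in> (\<lambda>h. h + p) ` power_ideal d" if "q - p \<in> power_ideal d" for q :: "('n, 'k) mpoly"
    using that by (rule rev_image_eqI) simp
  then show ?thesis by (auto simp: a_r_coset_def')
qed

text \<open>Turns equality in the quotient into the ideal membership with which the results on
  \<open>lin\<close> are stated.\<close>

lemma coset_eq_iff:
  "power_ideal d +>\<^bsub>mpoly_ring\<^esub> p = power_ideal d +>\<^bsub>mpoly_ring\<^esub> q \<longleftrightarrow> p - q \<in> power_ideal d"
proof
  assume "power_ideal d +>\<^bsub>mpoly_ring\<^esub> p = power_ideal d +>\<^bsub>mpoly_ring\<^esub> q"
  moreover have "p \<in> power_ideal d +>\<^bsub>mpoly_ring\<^esub> p" by (simp add: coset_mpoly_ring power_ideal_0)
  ultimately show "p - q \<in> power_ideal d" by (simp add: coset_mpoly_ring)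
next
  assume "p - q \<in> power_ideal d"
  then have "r - p \<in> power_ideal d \<longleftrightarrow> r - q \<in> power_ideal d" for r
    using power_ideal_diff_iff'[of "p - q" d "r - q"] by simp
  then show "power_ideal d +>\<^bsub>mpoly_ring\<^esub> p = power_ideal d +>\<^bsub>mpoly_ring\<^esub> q"
    by (simp add: coset_mpoly_ring)
qed

lemma coset_mult:
  "(power_ideal d +>\<^bsub>mpoly_ring\<^esub> p) \<otimes>\<^bsub>mpoly_ring Quot power_ideal d\<^esub> (power_ideal d +>\<^bsub>mpoly_ring\<^esub> q) =
    power_ideal d +>\<^bsub>mpoly_ring\<^esub> (p * q)"
  using ideal.rcoset_mult_add[OF ideal_power_ideal, of p q] by (simp add: FactRing_def)

lemma coset_power:
  "(power_ideal d +>\<^bsub>mpoly_ring\<^esub> p) [^]\<^bsub>mpoly_ring Quot power_ideal d\<^esub> (s::nat) =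
    power_ideal d +>\<^bsub>mpoly_ring\<^esub> (p ^ s)"
  for p :: "('n, 'k::comm_ring_1) mpoly"
proof -
  interpret Q: ring "mpoly_ring Quot (power_ideal d :: ('n, 'k) mpoly set)"
    by (rule ideal.quotient_is_ring[OF ideal_power_ideal])
  show ?thesis
    by (induction s) (simp add: FactRing_def, simp add: coset_mult mult.commute)
qed

section \<open>The artinian condition\<close>

text \<open>Induction on \<open>B\<close>: split off the coefficient of one monomial. Its vanishing on \<open>W k\<close> and
  its kernel in \<open>W k\<close> both stabilize.\<close>

lemma subspace_chain_stabilizes:
  fixes W :: "nat \<Rightarrow> ('a::cancel_comm_monoid_add \<Rightarrow>\<^sub>0 'k::field) set"
  assumes "finite B" "decseq W"
    and "\<And>k p q. p \<in> W k \<Longrightarrow> q \<in> W k \<Longrightarrow> p + q \<in> W k"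
    and "\<And>k c p. p \<in> W k \<Longrightarrow> Poly_Mapping.single 0 c * p \<in> W k"
    and "\<And>k p. p \<in> W k \<Longrightarrow> Poly_Mapping.keys p \<subseteq> B"
  shows "\<exists>N. \<forall>k\<ge>N. W k = W N"
  using assms
proof (induction B arbitrary: W rule: finite_induct)
  case empty
  then have W: "W k \<subseteq> {0}" for k by fastforce
  \<comment> \<open>Nothing forces \<open>0\<close> into \<open>W k\<close>, so the chain may still
    drop once from \<open>{0}\<close> to the empty set.\<close>
  show ?case
  proof (cases "\<forall>k. 0 \<in> W k")
    case True
    then have "W k = {0}" for k using W by blast
    then show ?thesis by simp
  next
    case False
    then obtain N where "0 \<notin> W N" by blast
    moreover have "W k \<subseteq> W N" if "k \<ge> N" for k using empty(1) that by (rule decseqD)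
    ultimately have "W k = {}" if "k \<ge> N" for k using W that by blast
    then show ?thesis by (metis order_refl)
  qed
next
  case (insert b B)
  note mono = decseqD[OF insert.prems(1)]
  define V where "V k = {p \<in> W k. Poly_Mapping.lookup p b = 0}" for k
  have "\<exists>N. \<forall>k\<ge>N. V k = V N"
  proof (rule insert.IH)
    show "decseq V" using mono by (fastforce simp: decseq_def V_def)
    show "p + q \<in> V k" if "p \<in> V k" "q \<in> V k" for k p q
      using that insert.prems by (simp add: V_def lookup_add)
    show "Poly_Mapping.single 0 c * p \<in> V k" if "p \<in> V k" for k c p
      using that insert.prems by (simp add: V_def lookup_const_mult)
    show "Poly_Mapping.keys p \<subseteq> B" if "p \<in> V k" for k p
      using that insert.prems(4)[of p k] by (auto simp: V_def in_keys_iff)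
  qed
  then obtain N where N: "V k = V N" if "k \<ge> N" for k by blast
  obtain M where M: "M \<ge> N" "(\<forall>p\<in>W M. Poly_Mapping.lookup p b = 0) \<or>
      (\<forall>k. \<exists>p\<in>W k. Poly_Mapping.lookup p b \<noteq> 0)"
  proof (cases "\<forall>k. \<exists>p\<in>W k. Poly_Mapping.lookup p b \<noteq> 0")
    case False
    then obtain k where "\<forall>p\<in>W k. Poly_Mapping.lookup p b = 0" by blast
    then show ?thesis using mono[of k "max k N"] by (intro that[of "max k N"]) auto
  qed (use that in blast)
  have "W M \<subseteq> W k" if k: "k \<ge> M" for k
  proof
    fix p assume p: "p \<in> W M"
    show "p \<in> W k"
    proof (cases "Poly_Mapping.lookup p b = 0")
      case True
      then have "p \<in> V M" using p by (simp add: V_def)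
      then have "p \<in> V k" using N[of k] N[of M] M k by simp
      then show ?thesis by (simp add: V_def)
    next
      case False
      then obtain q where q: "q \<in> W k" "Poly_Mapping.lookup q b \<noteq> 0" using M(2) p by blast
      \<comment> \<open>Subtracting this multiple of \<open>q\<close> from \<open>p\<close> kills
        the coefficient at \<open>b\<close> and leads into \<open>V\<close>, which is stable from
        \<open>N\<close> on.\<close>
      define c where "c = Poly_Mapping.lookup p b / Poly_Mapping.lookup q b"
      have "p + Poly_Mapping.single 0 (- c) * q \<in> W M"
        using q(1) mono[OF k] by (intro insert.prems p) auto
      then have "p + Poly_Mapping.single 0 (- c) * q \<in> V M"
        using q(2) by (simp add: V_def lookup_add lookup_const_mult c_def)
      then have "p + Poly_Mapping.single 0 (- c) * q \<in> V k"
        using N[of k] N[of M] M(1) k by simp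
      then have "p + Poly_Mapping.single 0 (- c) * q \<in> W k"
        by (simp add: V_def)
      then have "(p + Poly_Mapping.single 0 (- c) * q) + Poly_Mapping.single 0 c * q \<in> W k"
        using q(1) by (rule insert.prems(2)[OF _ insert.prems(3)])
      moreover have "(p + Poly_Mapping.single 0 (- c) * q) + Poly_Mapping.single 0 c * q = p"
        by (rule poly_mapping_eqI) (simp add: lookup_add lookup_const_mult)
      ultimately show ?thesis by (simp only:)
    qed
  qed
  then have "\<forall>k\<ge>M. W k = W M" using mono by blast
  then show ?case by blast
qed

text \<open>These are the monomials outside the ideal, whose cosets span the quotient.\<close>

lemma finite_reduced_monomials:
  "finite {m :: 'n::finite \<Rightarrow>\<^sub>0 nat. \<forall>i. Poly_Mapping.lookup m i < d i}" (is "finite ?B")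
proof (rule finite_imageD)
  have "Poly_Mapping.lookup ` ?B \<subseteq> PiE UNIV (\<lambda>i. {..<d i})" by auto
  then show "finite (Poly_Mapping.lookup ` ?B)"
    by (rule finite_subset) (simp add: finite_PiE)
qed (auto intro: inj_onI)

text \<open>Every coset has a representative supported on reduced monomials, so an ideal
  \<open>C k\<close> is determined by the space \<open>W k\<close> of its reduced
  representatives.\<close>

lemma artinian_quotient_power_ideal:
  "artinian_ring (mpoly_ring Quot (power_ideal d :: ('n::finite, 'k::field) mpoly set))"
  unfolding artinian_ring_def
proof (intro conjI allI impI)
  let ?I = "power_ideal d :: ('n, 'k) mpoly set"
  let ?Q = "mpoly_ring Quot ?I"
  let ?B = "{m :: 'n \<Rightarrow>\<^sub>0 nat. \<forall>i. Poly_Mapping.lookup m i < d i}"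
  show Q: "ring ?Q" by (rule ideal.quotient_is_ring[OF ideal_power_ideal])
  fix C :: "nat \<Rightarrow> ('n, 'k) mpoly set set"
  assume C: "(\<forall>k. ideal (C k) ?Q) \<and> decseq C"
  define W where "W k = {p. ?I +>\<^bsub>mpoly_ring\<^esub> p \<in> C k \<and> Poly_Mapping.keys p \<subseteq> ?B}" for k
  have vimage: "ideal {p. ?I +>\<^bsub>mpoly_ring\<^esub> p \<in> C k} mpoly_ring" for k
    using ring_hom_ring.ideal_vimage[OF ideal.rcos_ring_hom_ring[OF ideal_power_ideal], of "C k"] C by simp
  have "\<exists>N. \<forall>k\<ge>N. W k = W N"
  proof (rule subspace_chain_stabilizes[OF finite_reduced_monomials])
    show "decseq W" using C unfolding decseq_def W_def by blast
    show "Poly_Mapping.keys p \<subseteq> ?B" if "p \<in> W k" for k p using that by (simp add: W_def)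
    show "p + q \<in> W k" if "p \<in> W k" "q \<in> W k" for k p q
      using that keys_add[of p q]
        additive_subgroup.a_closed[OF ideal.axioms(1)[OF vimage[of k]], of p q]
      by (auto simp: W_def)
    show "Poly_Mapping.single 0 c * p \<in> W k" if "p \<in> W k" for k c p
      using that ideal.I_l_closed[OF vimage[of k], of p "Poly_Mapping.single 0 c"]
      by (auto simp: W_def in_keys_iff lookup_const_mult)
  qed
  then obtain N where N: "W k = W N" if "k \<ge> N" for k by blast
  have "C N \<subseteq> C k" if k: "k \<ge> N" for k
  proof
    fix x assume x: "x \<in> C N"
    interpret ideal "C N" ?Q using C by blast
    have "x \<in> carrier ?Q" using x by (rule a_Hcarr)
    then obtain p where p: "x = ?I +>\<^bsub>mpoly_ring\<^esub> p"
      by (auto simp: FactRing_def A_RCOSETS_def')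
    \<comment> \<open>The normal form of \<open>p\<close>: all terms divisible by some power
      \<open>Var i ^ d i\<close> are dropped.\<close>
    define q where "q = (\<Sum>m\<in>Poly_Mapping.keys p \<inter> ?B. Poly_Mapping.single m (Poly_Mapping.lookup p m))"
    have lookup_q: "Poly_Mapping.lookup q m = (if m \<in> ?B then Poly_Mapping.lookup p m else 0)" for m
      by (auto simp: q_def lookup_sum lookup_single when_def in_keys_iff)
    have "p - q \<in> ?I"
      by (auto simp: power_ideal_def in_keys_iff lookup_minus lookup_q not_less split: if_splits)
    then have x_q: "x = ?I +>\<^bsub>mpoly_ring\<^esub> q" using p coset_eq_iff by blast
    then have "q \<in> W N" using x by (auto simp: W_def x_q in_keys_iff lookup_q split: if_splits)
    then have "q \<in> W k" using N[OF k] by simp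
    then show "x \<in> C k" by (simp add: W_def x_q)
  qed
  then have "\<forall>k\<ge>N. C k = C N" using C by (auto dest: decseqD)
  then show "\<exists>N. \<forall>k\<ge>N. C k = C N" by blast
qed

theorem theorem3p1:
  fixes d :: "'n::finite \<Rightarrow> nat"
  assumes "\<And>i. d i > 0"
    and "CHAR('k::field) = 0 \<or> CHAR('k) > (\<Sum>i\<in>UNIV. d i) - CARD('n)"
  shows "strong_Lefschetz_property
           (Idl\<^bsub>mpoly_ring\<^esub> {Var i ^ d i | i. i \<in> UNIV} :: ('n, 'k) mpoly set)"
proof -
  let ?I = "power_ideal d :: ('n, 'k) mpoly set"
  \<comment> \<open>Positivity of the \<open>d i\<close> makes the natural subtraction in the
    hypothesis exact, so the bound on the characteristic is the socle degree.\<close>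
  have "(\<Sum>i\<in>UNIV. d i) \<ge> CARD('n)"
    using sum_mono[of UNIV "\<lambda>_. 1" d] assms(1) by (simp add: Suc_le_eq)
  then have "socle_degree d = int ((\<Sum>i\<in>UNIV. d i) - CARD('n))"
    by (simp add: socle_degree_def sum_subtractf of_nat_diff)
  then have char: "CHAR('k) = 0 \<or> int CHAR('k) > socle_degree d"
    using assms(2) by linarith
  have "homogeneous (d i * 1) (Var i ^ d i :: ('n, 'k) mpoly)" for i
    by (intro homogeneous_power homogeneous_Var)
  then have "homogeneous_ideal ?I"
    unfolding homogeneous_ideal_def Idl_Var_powers[symmetric]
    by (intro exI[of _ "{Var i ^ d i | i. i \<in> UNIV}"]) auto
  moreover have "\<exists>l \<in> graded_component ?I 1. \<forall>i s :: nat.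
        let f = (\<lambda>a. l [^]\<^bsub>mpoly_ring Quot ?I\<^esub> s \<otimes>\<^bsub>mpoly_ring Quot ?I\<^esub> a) in
          inj_on f (graded_component ?I i) \<or>
          f ` graded_component ?I i = graded_component ?I (i + s)"
    unfolding Let_def
  proof (intro bexI allI)
    let ?l = "?I +>\<^bsub>mpoly_ring\<^esub> lin"
    show "?l \<in> graded_component ?I 1"
      unfolding graded_component_def using homogeneous_lin by blast
    fix i s :: nat
    define f where "f = (\<lambda>a. ?l [^]\<^bsub>mpoly_ring Quot ?I\<^esub> s \<otimes>\<^bsub>mpoly_ring Quot ?I\<^esub> a)"
    have f: "f (?I +>\<^bsub>mpoly_ring\<^esub> p) = ?I +>\<^bsub>mpoly_ring\<^esub> (lin ^ s * p)" for p
      by (simp only: f_def coset_power coset_mult)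
    have "inj_on f (graded_component ?I i) \<or> f ` graded_component ?I i = graded_component ?I (i + s)"
    \<comment> \<open>The map goes from degree \<open>i\<close> to \<open>i + s\<close>; it is
      injective if these add up to at most the socle degree, surjective otherwise.\<close>
    proof (cases "int s + 2 * int i \<le> socle_degree d")
      case True
      have "inj_on f (graded_component ?I i)"
      proof (rule inj_onI)
        fix x y assume "x \<in> graded_component ?I i" "y \<in> graded_component ?I i" and eq: "f x = f y"
        then obtain p q where p: "x = ?I +>\<^bsub>mpoly_ring\<^esub> p" "homogeneous i p"
          and q: "y = ?I +>\<^bsub>mpoly_ring\<^esub> q" "homogeneous i q"
          by (auto simp: graded_component_def)
        have "lin ^ s * (p - q) \<in> ?I"
          using eq by (simp add: p q f coset_eq_iff right_diff_distrib)
        then have "p - q \<in> ?I"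
          by (rule lin_power_injective[OF char homogeneous_diff[OF p(2) q(2)] True])
        then show "x = y" by (simp add: p q coset_eq_iff)
      qed
      then show ?thesis ..
    next
      case False
      have "f ` graded_component ?I i = graded_component ?I (i + s)"
      proof
        show "f ` graded_component ?I i \<subseteq> graded_component ?I (i + s)"
          by (auto simp: graded_component_def f intro!: imageI homogeneous_lin_power_mult)
        show "graded_component ?I (i + s) \<subseteq> f ` graded_component ?I i"
        proof
          fix z assume "z \<in> graded_component ?I (i + s)"
          then obtain y where y: "z = ?I +>\<^bsub>mpoly_ring\<^esub> y" "homogeneous (i + s) y"
            by (auto simp: graded_component_def)
          have "int s + socle_degree d \<le> 2 * int (i + s)" using False by simp
          then obtain x where x: "homogeneous i x" "y - lin ^ s * x \<in> ?I"
            using lin_power_surjective[OF char y(2)] by blast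
          then have "z = f (?I +>\<^bsub>mpoly_ring\<^esub> x)" by (simp add: y f coset_eq_iff)
          then show "z \<in> f ` graded_component ?I i"
            using x(1) by (auto simp: graded_component_def)
        qed
      qed
      then show ?thesis ..
    qed
    then show "inj_on (\<lambda>a. ?l [^]\<^bsub>mpoly_ring Quot ?I\<^esub> s \<otimes>\<^bsub>mpoly_ring Quot ?I\<^esub> a) (graded_component ?I i) \<or>
        (\<lambda>a. ?l [^]\<^bsub>mpoly_ring Quot ?I\<^esub> s \<otimes>\<^bsub>mpoly_ring Quot ?I\<^esub> a) ` graded_component ?I i
          = graded_component ?I (i + s)"
      unfolding f_def .
  qed
  ultimately show ?thesis
    unfolding Idl_Var_powers strong_Lefschetz_property_def
    using artinian_quotient_power_ideal by blast
qed

end
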